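(* Let $G$ be a finite simple graph, let $uv\in E(G)$ and let $B\subseteq V(G)$. Then $$C_B(G;x)=C_B(G-uv;x)+x^2\,C_{B\cap N(u)\cap N(v)}(G[N(u)\cap N(v)];x).$$
   Context: For a finite simple graph $G$ and a subset $B\subseteq V(G)$, the $B$-restricted clique polynomial is $C_B(G;x)=\sum_{i=0}^{\omega(G[B])} c_i(B)x^i$, where $c_i(B)$ is the number of subsets $K\subseteq B$ with $|K|=i$ that are cliques in $G$ (pairwise adjacent vertices); the empty set counts as a clique, so $c_0(B)=1$. Here $G[S]$ is the subgraph of $G$ induced by $S$, $\omega$ is the clique number, $N(v)$ is the (open) neighbourhood of $v$ in $G$, and $G-uv$ is the graph obtained by deleting the edge $uv$ (keeping all vertices).
   Formalization: The formal theorem assumes in addition that both endpoints u and v lie in B; otherwise the identity is false (G = K_2 with B empty would give 1 = 1 + x^2), and it holds only when u and v are in B. *)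

theory Defs
  imports
    "HOL-Computational_Algebra.Polynomial"
    "Graph_Theory.Digraph_Component"
begin

text \<open>
  A finite simple graph is an instance of the locale \<^locale>\<open>graph\<close>: a finite, loop-free, symmetric
  digraph without parallel arcs. An undirected edge \<open>uv\<close> is the pair of arcs from \<open>u\<close> to \<open>v\<close>
  and from \<open>v\<close> to \<open>u\<close>.
\<close>

definition nbhd :: "('a, 'b) pre_digraph \<Rightarrow> 'a \<Rightarrow> 'a set" where
  "nbhd G v = {w \<in> verts G. v \<rightarrow>\<^bsub>G\<^esub> w}"

text \<open>Both arcs representing the undirected edge \<open>uv\<close> are removed.\<close>

definition del_edge :: "('a, 'b) pre_digraph \<Rightarrow> 'a \<Rightarrow> 'a \<Rightarrow> ('a, 'b) pre_digraph" where
  "del_edge G u v = G\<lparr>arcs := {e \<in> arcs G. arc_to_ends G e \<notin> {(u, v), (v, u)}}\<rparr>"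

definition is_clique :: "('a, 'b) pre_digraph \<Rightarrow> 'a set \<Rightarrow> bool" where
  "is_clique G K \<longleftrightarrow> K \<subseteq> verts G \<and> pairwise (\<lambda>x y. x \<rightarrow>\<^bsub>G\<^esub> y) K"

definition clique_number :: "('a, 'b) pre_digraph \<Rightarrow> nat" where
  "clique_number G = Max (card ` {K. is_clique G K})"

definition clique_count :: "('a, 'b) pre_digraph \<Rightarrow> 'a set \<Rightarrow> nat \<Rightarrow> nat" where
  "clique_count G B i = card {K. K \<subseteq> B \<and> card K = i \<and> is_clique G K}"

definition clique_poly :: "('a, 'b) pre_digraph \<Rightarrow> 'a set \<Rightarrow> int poly" where
  "clique_poly G B =
     (\<Sum>i = 0..clique_number (G \<restriction> B). monom (int (clique_count G B i)) i)"

lemma verts_del_edge [simp]: "verts (del_edge G u v) = verts G"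
  by (simp add: del_edge_def)

lemma arcs_ends_del_edge [simp]:
  "arcs_ends (del_edge G u v) = arcs_ends G - {(u, v), (v, u)}"
  by (auto simp: del_edge_def arcs_ends_def arc_to_ends_def)

lemma graph_del_edge:
  assumes "graph G"
  shows "graph (del_edge G u v)"
proof -
  interpret graph G by fact
  have sym: "symmetric (del_edge G u v)"
    using sym_arcs by (auto simp: symmetric_def sym_def)
  show ?thesis
    by unfold_locales (use sym no_loops no_multi_arcs in
      \<open>auto simp: del_edge_def arc_to_ends_def\<close>)
qed

lemma arcs_ends_induce_subgraph:
  "arcs_ends (G \<restriction> S) = arcs_ends G \<inter> S \<times> S"
  by (auto simp: arcs_ends_def arc_to_ends_def)

lemma is_clique_induce_subgraph:
  assumes "S \<subseteq> verts G"
  shows "is_clique (G \<restriction> S) K \<longleftrightarrow> K \<subseteq> S \<and> is_clique G K"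
  using assms by (auto simp: is_clique_def pairwise_def arcs_ends_induce_subgraph)

lemma coeff_0_clique_poly:
  assumes "finite B"
  shows "coeff (clique_poly G B) 0 = 1"
proof -
  have "{K. K \<subseteq> B \<and> card K = 0 \<and> is_clique G K} = {{}}"
    using assms by (auto simp: is_clique_def card_eq_0_iff dest: finite_subset)
  then have "clique_count G B 0 = 1"
    by (simp add: clique_count_def)
  then show ?thesis
    by (simp add: clique_poly_def coeff_sum if_distrib cong: if_cong)
qed

text \<open>
  The edge-deletion recurrence for restricted clique polynomials needs both endpoints of the deleted
  edge to lie in \<open>B\<close>: otherwise no clique inside \<open>B\<close> uses that edge, so deleting it does
  not change the polynomial, whereas the correction term always contains the monomial \<open>x^2\<close>.
\<close>

lemma clique_poly_del_edge_outside:
  assumes "B \<subseteq> verts G" "\<not> (u \<in> B \<and> v \<in> B)"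
  shows "clique_poly (del_edge G u v) B = clique_poly G B"
proof -
  have cl: "is_clique (del_edge G u v) K \<longleftrightarrow> is_clique G K" if "K \<subseteq> B" for K
    using that assms(2) by (auto simp: is_clique_def pairwise_def)
  have "is_clique (del_edge G u v \<restriction> B) = is_clique (G \<restriction> B)"
    using cl assms(1) by (auto simp: is_clique_induce_subgraph fun_eq_iff)
  moreover have "clique_count (del_edge G u v) B = clique_count G B"
    using cl by (auto simp: clique_count_def fun_eq_iff intro!: arg_cong[where f = card])
  ultimately show ?thesis
    by (simp add: clique_poly_def clique_number_def)
qed

lemma edge_recurrence_imp_endpoints_in:
  assumes "graph G" "B \<subseteq> verts G"
    and eq: "clique_poly G B = clique_poly (del_edge G u v) B +
      monom 1 2 * clique_poly (G \<restriction> (nbhd G u \<inter> nbhd G v)) (B \<inter> nbhd G u \<inter> nbhd G v)"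
  shows "u \<in> B \<and> v \<in> B"
proof (rule ccontr)
  let ?P = "clique_poly (G \<restriction> (nbhd G u \<inter> nbhd G v)) (B \<inter> nbhd G u \<inter> nbhd G v)"
  assume "\<not> (u \<in> B \<and> v \<in> B)"
  then have "monom 1 2 * ?P = 0"
    using eq clique_poly_del_edge_outside[OF assms(2)] by simp
  then have "?P = 0"
    by simp
  moreover have "finite B"
    using assms(1,2) fin_digraph.finite_verts finite_subset
    unfolding graph_def digraph_def by blast
  ultimately show False
    using coeff_0_clique_poly[of "B \<inter> nbhd G u \<inter> nbhd G v" "G \<restriction> (nbhd G u \<inter> nbhd G v)"]
    by simp
qed

end

theory Submission
  imports Defs
begin

text \<open>
  The polynomial is the generating function of the cliques inside \<open>B\<close> by size. A clique of \<open>G\<close>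
  inside \<open>B\<close> is a clique of \<open>G - uv\<close> unless it contains both \<open>u\<close> and \<open>v\<close>; in the latter case
  removing \<open>u\<close> and \<open>v\<close> leaves a clique in the common neighbourhood that is smaller by two.
\<close>

definition cliques_in :: "('a, 'b) pre_digraph \<Rightarrow> 'a set \<Rightarrow> 'a set set" where
  "cliques_in G B = {K. K \<subseteq> B \<and> is_clique G K}"

lemma finite_cliques_in: "finite B \<Longrightarrow> finite (cliques_in G B)"
  by (rule finite_subset[of _ "Pow B"]) (auto simp: cliques_in_def)

text \<open>Grouping the cliques by size turns each coefficient into a sum of monomials, one per
  clique. In this form a partition or a bijection of cliques yields a polynomial identity at
  once.\<close>

lemma clique_poly_eq_sum_cliques:
  assumes "finite B" "B \<subseteq> verts G"
  shows "clique_poly G B = (\<Sum>K\<in>cliques_in G B. monom 1 (card K))"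
proof -
  have induced: "{K. is_clique (G \<restriction> B) K} = cliques_in G B"
    using assms(2) by (simp add: is_clique_induce_subgraph cliques_in_def)
  have fin: "finite (cliques_in G B)"
    using assms(1) by (rule finite_cliques_in)
  \<comment> \<open>The cutoff at the clique number loses nothing: the cliques inside
    \<open>B\<close> are exactly the cliques of the induced graph whose maximal size it is.\<close>
  have "card ` cliques_in G B \<subseteq> {0..clique_number (G \<restriction> B)}"
    using fin by (auto simp: clique_number_def induced)
  then have "(\<Sum>K\<in>cliques_in G B. monom (1::int) (card K)) =
      (\<Sum>i = 0..clique_number (G \<restriction> B). \<Sum>K | K \<in> cliques_in G B \<and> card K = i. monom 1 (card K))"
    using fin by (intro sum.group[symmetric]) auto
  also have "\<dots> = (\<Sum>i = 0..clique_number (G \<restriction> B). monom (int (clique_count G B i)) i)"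
  proof (rule sum.cong[OF refl])
    fix i
    have "{K \<in> cliques_in G B. card K = i} = {K. K \<subseteq> B \<and> card K = i \<and> is_clique G K}"
      by (auto simp: cliques_in_def)
    then show "(\<Sum>K | K \<in> cliques_in G B \<and> card K = i. monom 1 (card K)) =
        monom (int (clique_count G B i)) i"
      by (simp add: clique_count_def of_nat_poly smult_monom flip: of_nat_monom)
  qed
  finally show ?thesis
    by (simp add: clique_poly_def)
qed

text \<open>The two deleted arcs matter only to a set having \<open>u\<close> and \<open>v\<close>
  as different elements; \<open>pairwise\<close> never compares an element with itself, whence
  \<open>u \<noteq> v\<close>.\<close>

lemma is_clique_del_edge_iff:
  assumes "u \<noteq> v"
  shows "is_clique (del_edge G u v) K \<longleftrightarrow> is_clique G K \<and> \<not> (u \<in> K \<and> v \<in> K)"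
  using assms by (auto simp: is_clique_def pairwise_def)

text \<open>As \<open>u\<close> and \<open>v\<close> are adjacent, the only new requirements on
  \<open>K\<close> are arcs to and from \<open>u\<close> and \<open>v\<close>; \<open>nbhd\<close>
  records outgoing arcs, and symmetry supplies the incoming ones.\<close>

lemma (in graph) is_clique_insert_edge_iff:
  assumes "u \<rightarrow>\<^bsub>G\<^esub> v" "u \<notin> K" "v \<notin> K"
  shows "is_clique G (insert u (insert v K)) \<longleftrightarrow>
    K \<subseteq> nbhd G u \<inter> nbhd G v \<and> is_clique G K"
proof -
  have sym: "x \<rightarrow>\<^bsub>G\<^esub> y \<Longrightarrow> y \<rightarrow>\<^bsub>G\<^esub> x" for x y
    using sym_arcs by (auto simp: symmetric_def dest: symD)
  have "u \<in> verts G" "v \<in> verts G"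
    using assms(1) by (auto dest: adj_in_verts)
  then show ?thesis
    using assms sym[of u] sym[of v] unfolding is_clique_def nbhd_def pairwise_insert by blast
qed

theorem lemma2p3:
  fixes G :: "('a, 'b) pre_digraph" and u v :: 'a and B :: "'a set"
  assumes "graph G"
    and "u \<rightarrow>\<^bsub>G\<^esub> v"
    and "B \<subseteq> verts G"
    and "u \<in> B" and "v \<in> B"
  shows "clique_poly G B =
    clique_poly (del_edge G u v) B +
    monom 1 2 * clique_poly (G \<restriction> (nbhd G u \<inter> nbhd G v)) (B \<inter> nbhd G u \<inter> nbhd G v)"
proof -
  interpret graph G by fact
  let ?N = "nbhd G u \<inter> nbhd G v"
  let ?C = "B \<inter> nbhd G u \<inter> nbhd G v"
  let ?H = "G \<restriction> ?N"
  let ?f = "\<lambda>K. insert u (insert v K)"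
  have fin: "finite B"
    using assms(3) finite_verts by (rule finite_subset)
  then have finC: "finite ?C"
    by auto
  \<comment> \<open>Without loops the common neighbourhood avoids both endpoints, so
    \<open>?f\<close> always adds two new vertices.\<close>
  have "x \<notin> nbhd G x" for x
    using adj_not_same[of x] unfolding nbhd_def by blast
  then have uN: "u \<notin> ?N" and vN: "v \<notin> ?N"
    by auto
  have "u \<noteq> v"
    using assms(2) adj_not_same by blast
  have N_verts: "?N \<subseteq> verts G"
    by (auto simp: nbhd_def)
  have H: "K \<in> cliques_in ?H ?C \<longleftrightarrow> K \<subseteq> B \<and> K \<subseteq> ?N \<and> is_clique G K" for K
    using is_clique_induce_subgraph[OF N_verts] by (auto simp: cliques_in_def)
  have "{K \<in> cliques_in G B. u \<in> K \<and> v \<in> K} = ?f ` cliques_in ?H ?C"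
  proof (intro set_eqI iffI)
    fix K assume K: "K \<in> {K \<in> cliques_in G B. u \<in> K \<and> v \<in> K}"
    then have eq: "K = ?f (K - {u, v})"
      by auto
    have "is_clique G K"
      using K by (simp add: cliques_in_def)
    then have "is_clique G (?f (K - {u, v}))"
      by (subst (asm) eq)
    then have "K - {u, v} \<in> cliques_in ?H ?C"
      using K is_clique_insert_edge_iff[OF assms(2), of "K - {u, v}"]
      unfolding H by (auto simp: cliques_in_def)
    with eq show "K \<in> ?f ` cliques_in ?H ?C"
      by blast
  next
    fix K assume "K \<in> ?f ` cliques_in ?H ?C"
    then obtain L where L: "K = ?f L" "L \<subseteq> B" "L \<subseteq> ?N" "is_clique G L"
      unfolding image_iff Bex_def H by blast
    with uN vN have "u \<notin> L" "v \<notin> L"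
      by blast+
    \<comment> \<open>Here both endpoints must lie in \<open>B\<close>, so that the enlarged clique
      stays inside \<open>B\<close>.\<close>
    then show "K \<in> {K \<in> cliques_in G B. u \<in> K \<and> v \<in> K}"
      using L assms(4,5) is_clique_insert_edge_iff[OF assms(2), of L]
      by (auto simp: cliques_in_def)
  qed
  moreover have "cliques_in (del_edge G u v) B = {K \<in> cliques_in G B. \<not> (u \<in> K \<and> v \<in> K)}"
    using is_clique_del_edge_iff[OF \<open>u \<noteq> v\<close>, of G] by (auto simp: cliques_in_def)
  ultimately have split: "cliques_in G B = cliques_in (del_edge G u v) B \<union> ?f ` cliques_in ?H ?C"
    and disj: "cliques_in (del_edge G u v) B \<inter> ?f ` cliques_in ?H ?C = {}"
    by blast+
  have notin: "u \<notin> K" "v \<notin> K" "finite K" if "K \<in> cliques_in ?H ?C" for K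
    using that uN vN fin unfolding H by (auto dest: finite_subset)
  \<comment> \<open>A clique avoiding \<open>u\<close> and \<open>v\<close> is recovered from its
    image by deleting them.\<close>
  have inj: "inj_on ?f (cliques_in ?H ?C)"
  proof (rule inj_onI)
    fix K L assume "K \<in> cliques_in ?H ?C" "L \<in> cliques_in ?H ?C" "?f K = ?f L"
    with notin(1,2) show "K = L"
      by (metis \<open>u \<noteq> v\<close> insert_ident insert_iff)
  qed
  have "clique_poly G B = (\<Sum>K\<in>cliques_in G B. monom 1 (card K))"
    by (rule clique_poly_eq_sum_cliques[OF fin assms(3)])
  also have "\<dots> = (\<Sum>K\<in>cliques_in (del_edge G u v) B. monom 1 (card K)) +
      (\<Sum>K\<in>?f ` cliques_in ?H ?C. monom 1 (card K))"
    unfolding split using disj fin finC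
    by (intro sum.union_disjoint) (auto intro: finite_cliques_in)
  \<comment> \<open>The factor \<open>monom 1 2\<close> accounts for the two vertices that
    \<open>?f\<close> adds.\<close>
  also have "(\<Sum>K\<in>?f ` cliques_in ?H ?C. monom (1::int) (card K)) =
      (\<Sum>K\<in>cliques_in ?H ?C. monom 1 2 * monom 1 (card K))"
    using notin \<open>u \<noteq> v\<close> by (subst sum.reindex[OF inj]) (auto intro!: sum.cong simp: mult_monom)
  also have "\<dots> = monom 1 2 * clique_poly ?H ?C"
    using finC by (subst clique_poly_eq_sum_cliques) (auto simp: sum_distrib_left)
  finally show ?thesis
    using fin assms(3) by (simp add: clique_poly_eq_sum_cliques)
qed

end
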